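(* Let $m\ge 4s+1$. Then a generic $(\mathbf A,\mathbf b)\in\mathbb C^{m\times(d+1)}$ is $s$-sparse affine phase retrievable for $\mathbb C^d$.
   Context: For $\mathbf u,\mathbf v\in\mathbb C^d$, $\langle\mathbf u,\mathbf v\rangle=\sum_i\overline{u_i}v_i$. Write $(\mathbf A,\mathbf b)$ with $\mathbf A=(\mathbf a_1,\ldots,\mathbf a_m)^\top\in\mathbb C^{m\times d}$, $\mathbf b=(b_1,\ldots,b_m)^\top\in\mathbb C^m$, and $\mathbf M_{\mathbf A,\mathbf b}(\mathbf x)=(|\langle\mathbf a_1,\mathbf x\rangle+b_1|,\ldots,|\langle\mathbf a_m,\mathbf x\rangle+b_m|)$. Let $\Sigma_s(\mathbb C^d)=\{\mathbf x\in\mathbb C^d:\|\mathbf x\|_0\le s\}$ ($\|\mathbf x\|_0$ = number of nonzero entries). $(\mathbf A,\mathbf b)$ is $s$-sparse affine phase retrievable for $\mathbb C^d$ if $\mathbf M_{\mathbf A,\mathbf b}$ is injective on $\Sigma_s(\mathbb C^d)$. A property holds for generic elements of $\mathbb C^N$ if it holds on a dense open set whose complement is a null set. *)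

theory Defs
  imports "HOL-Analysis.Analysis"
begin

definition cinner :: "complex^'d \<Rightarrow> complex^'d \<Rightarrow> complex" where
  "cinner u v = (\<Sum>i\<in>UNIV. cnj (u $ i) * v $ i)"

definition meas :: "complex^'d^'m \<Rightarrow> complex^'m \<Rightarrow> complex^'d \<Rightarrow> real^'m" where
  "meas A b x = (\<chi> j. cmod (cinner (A $ j) x + b $ j))"

definition sparse_vecs :: "nat \<Rightarrow> (complex^'d) set" where
  "sparse_vecs s = {x. card {i. x $ i \<noteq> 0} \<le> s}"

definition sparse_affine_pr :: "nat \<Rightarrow> complex^'d^'m \<Rightarrow> complex^'m \<Rightarrow> bool" where
  "sparse_affine_pr s A b \<longleftrightarrow> inj_on (meas A b) (sparse_vecs s)"

definition generic :: "('a::euclidean_space \<Rightarrow> bool) \<Rightarrow> bool" where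
  "generic P \<longleftrightarrow> (\<exists>S. open S \<and> closure S = UNIV \<and> (UNIV - S) \<in> null_sets lborel
                      \<and> (\<forall>z\<in>S. P z))"

end

(*
The parameters (A, b) admitting a collision |<a_j, x> + b_j| = |<a_j, y> + b_j| of two distinct
s-sparse vectors form a finite union of images of polynomial maps in at most 4s + m(2d + 1)
variables: x and y contribute 4s, and each row loses one of its 2d + 2 real degrees of freedom.
For m > 4s this is less than the real dimension m(2d + 2) of the parameter space. Comparing the
number of monomials of degree at most D in the coordinates with the number of monomials in the
variables, for D large, yields a nonzero polynomial vanishing on each image. Its zero set is closed
and null, so no dimension theory for the closure of the collision set is needed.
*)

theory Submission
  imports Defs
begin

section \<open>Underdetermined homogeneous linear systems\<close>

text \<open>Gaussian elimination, by induction on the equations: an unknown \<open>p\<close> with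
  nonzero coefficient in the new equation is eliminated from the others.\<close>

lemma homogeneous_system_nontrivial_solution:
  fixes C :: "'a \<Rightarrow> 'b \<Rightarrow> 'c::field"
  assumes "finite T" "finite S" "card T < card S"
  shows "\<exists>c. (\<exists>a\<in>S. c a \<noteq> 0) \<and> (\<forall>e\<in>T. (\<Sum>a\<in>S. c a * C a e) = 0)"
  using assms
proof (induction T arbitrary: S C rule: finite_induct)
  case empty
  then obtain a where "a \<in> S" by fastforce
  then show ?case by (intro exI[of _ "\<lambda>_. 1"]) auto
next
  case (insert e T)
  show ?case
  proof (cases "\<forall>a\<in>S. C a e = 0")
    case True
    obtain c where "\<exists>a\<in>S. c a \<noteq> 0" "\<forall>f\<in>T. (\<Sum>a\<in>S. c a * C a f) = 0"
      using insert.IH[of S C] insert.prems insert.hyps by auto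
    with True show ?thesis by (intro exI[of _ c]) auto
  next
    case False
    then obtain p where p: "p \<in> S" "C p e \<noteq> 0" by auto
    define S' where "S' = S - {p}"
    have S': "finite S'" "p \<notin> S'" "S = insert p S'"
      using p insert.prems by (auto simp: S'_def)
    then have "card T < card S'"
      using insert.prems insert.hyps by auto
    then obtain c where c: "\<exists>a\<in>S'. c a \<noteq> 0"
        "\<And>f. f \<in> T \<Longrightarrow> (\<Sum>a\<in>S'. c a * (C a f - C a e / C p e * C p f)) = 0"
      using insert.IH[OF S'(1), of "\<lambda>a f. C a f - C a e / C p e * C p f"] by auto
    \<comment> \<open>The value of the eliminated unknown \<open>p\<close> that solves equation
      \<open>e\<close>.\<close>
    define k where "k = - (\<Sum>a\<in>S'. c a * C a e) / C p e"
    have sum_upd: "(\<Sum>a\<in>S. (c(p := k)) a * C a f) = k * C p f + (\<Sum>a\<in>S'. c a * C a f)" for f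
    proof -
      have "(\<Sum>a\<in>S'. (c(p := k)) a * C a f) = (\<Sum>a\<in>S'. c a * C a f)"
        using S'(2) by (intro sum.cong) auto
      then show ?thesis using S' by simp
    qed
    have "(\<Sum>a\<in>S. (c(p := k)) a * C a f) = 0" if "f \<in> insert e T" for f
    proof (cases "f = e")
      case True
      then show ?thesis using p sum_upd[of e] by (simp add: k_def del: fun_upd_apply)
    next
      case False
      with that have "f \<in> T" by auto
      from c(2)[OF this] have "(\<Sum>a\<in>S'. c a * C a f) = (\<Sum>a\<in>S'. c a * C a e / C p e * C p f)"
        by (simp add: right_diff_distrib sum_subtractf mult.assoc)
      also have "\<dots> = - k * C p f"
        by (simp add: k_def sum_distrib_right sum_divide_distrib)
      finally show ?thesis using sum_upd[of f] by (simp del: fun_upd_apply)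
    qed
    moreover have "\<exists>a\<in>S. (c(p := k)) a \<noteq> 0"
      using c(1) S' by auto
    ultimately show ?thesis by blast
  qed
qed

section \<open>Polynomial functions of bounded degree in each variable\<close>

text \<open>Bounding the degree in each variable, not the total degree, makes the exponents a box,
  so for finite \<open>V\<close> there are \<open>(D + 1) ^ card V\<close> of them.\<close>

definition polyfun_deg :: "'v set \<Rightarrow> nat \<Rightarrow> (('v \<Rightarrow> complex) \<Rightarrow> complex) set" where
  "polyfun_deg V D = {f. \<exists>c. \<forall>t. f t = (\<Sum>e\<in>PiE V (\<lambda>_. {..D}). c e * (\<Prod>v\<in>V. t v ^ e v))}"

lemma polyfun_deg_add:
  assumes "f \<in> polyfun_deg V D" "g \<in> polyfun_deg V D"
  shows "(\<lambda>t. f t + g t) \<in> polyfun_deg V D"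
proof -
  from assms obtain c c' where
    "\<And>t. f t = (\<Sum>e\<in>PiE V (\<lambda>_. {..D}). c e * (\<Prod>v\<in>V. t v ^ e v))"
    "\<And>t. g t = (\<Sum>e\<in>PiE V (\<lambda>_. {..D}). c' e * (\<Prod>v\<in>V. t v ^ e v))"
    unfolding polyfun_deg_def by blast
  then show ?thesis
    unfolding polyfun_deg_def
    by (auto intro!: exI[of _ "\<lambda>e. c e + c' e"] simp: sum.distrib distrib_right)
qed

lemma polyfun_deg_cmult:
  assumes "f \<in> polyfun_deg V D"
  shows "(\<lambda>t. a * f t) \<in> polyfun_deg V D"
proof -
  from assms obtain c where
    "\<And>t. f t = (\<Sum>e\<in>PiE V (\<lambda>_. {..D}). c e * (\<Prod>v\<in>V. t v ^ e v))"
    unfolding polyfun_deg_def by blast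
  then show ?thesis
    unfolding polyfun_deg_def
    by (auto intro!: exI[of _ "\<lambda>e. a * c e"] simp: sum_distrib_left mult.assoc)
qed

lemma polyfun_deg_zero: "(\<lambda>t. 0) \<in> polyfun_deg V D"
  unfolding polyfun_deg_def by (auto intro!: exI[of _ "\<lambda>_. 0"])

lemma polyfun_deg_sum:
  assumes "\<And>i. i \<in> A \<Longrightarrow> f i \<in> polyfun_deg V D"
  shows "(\<lambda>t. \<Sum>i\<in>A. f i t) \<in> polyfun_deg V D"
  using assms
  by (induction A rule: infinite_finite_induct) (auto intro: polyfun_deg_zero polyfun_deg_add)

lemma polyfun_deg_monomial:
  assumes "finite V" "\<And>v. v \<in> V \<Longrightarrow> e v \<le> D"
  shows "(\<lambda>t. \<Prod>v\<in>V. t v ^ e v) \<in> polyfun_deg V D"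
proof -
  have "(\<Prod>v\<in>V. t v ^ e v) = (\<Sum>e'\<in>PiE V (\<lambda>_. {..D}).
          (if e' = restrict e V then 1 else 0) * (\<Prod>v\<in>V. t v ^ e' v))" for t :: "'a \<Rightarrow> complex"
  proof -
    have "restrict e V \<in> PiE V (\<lambda>_. {..D})" using assms by auto
    then show ?thesis
      using assms(1) by (simp add: finite_PiE if_distrib[of "\<lambda>x. x * _"] cong: if_cong prod.cong)
  qed
  then show ?thesis unfolding polyfun_deg_def mem_Collect_eq
    by (intro exI[of _ "\<lambda>e'. if e' = restrict e V then 1 else 0"] allI)
qed

lemma polyfun_deg_mono:
  assumes "finite V" "f \<in> polyfun_deg V D" "D \<le> D'"
  shows "f \<in> polyfun_deg V D'"
proof -
  from assms obtain c where c:
    "f = (\<lambda>t. \<Sum>e\<in>PiE V (\<lambda>_. {..D}). c e * (\<Prod>v\<in>V. t v ^ e v))"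
    unfolding polyfun_deg_def by blast
  show ?thesis unfolding c
    using assms by (intro polyfun_deg_sum polyfun_deg_cmult polyfun_deg_monomial) (auto simp: PiE_iff intro: order_trans)
qed

lemma polyfun_deg_mult:
  assumes "finite V" "f \<in> polyfun_deg V D" "g \<in> polyfun_deg V D'"
  shows "(\<lambda>t. f t * g t) \<in> polyfun_deg V (D + D')"
proof -
  from assms obtain c c' where c:
    "f = (\<lambda>t. \<Sum>e\<in>PiE V (\<lambda>_. {..D}). c e * (\<Prod>v\<in>V. t v ^ e v))"
    "g = (\<lambda>t. \<Sum>e\<in>PiE V (\<lambda>_. {..D'}). c' e * (\<Prod>v\<in>V. t v ^ e v))"
    unfolding polyfun_deg_def by blast
  have "(\<lambda>t. f t * g t) = (\<lambda>t. \<Sum>e\<in>PiE V (\<lambda>_. {..D}). \<Sum>e'\<in>PiE V (\<lambda>_. {..D'}).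
          (c e * c' e') * (\<Prod>v\<in>V. t v ^ (e v + e' v)))"
    unfolding c sum_product
    by (intro ext sum.cong refl) (simp add: power_add prod.distrib mult_ac)
  also have "\<dots> \<in> polyfun_deg V (D + D')"
    using assms(1)
    by (intro polyfun_deg_sum polyfun_deg_cmult polyfun_deg_monomial) (auto simp: PiE_iff intro: add_mono)
  finally show ?thesis .
qed

lemma polyfun_deg_one: "finite V \<Longrightarrow> (\<lambda>t. 1) \<in> polyfun_deg V D"
  using polyfun_deg_monomial[of V "\<lambda>_. 0" D] by simp

lemma polyfun_deg_power:
  assumes "finite V" "f \<in> polyfun_deg V D"
  shows "(\<lambda>t. f t ^ n) \<in> polyfun_deg V (n * D)"
  by (induction n) (auto intro: polyfun_deg_one polyfun_deg_mult assms)

lemma polyfun_deg_prod: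
  assumes "finite V" "finite B" "\<And>b. b \<in> B \<Longrightarrow> f b \<in> polyfun_deg V D"
  shows "(\<lambda>t. \<Prod>b\<in>B. f b t) \<in> polyfun_deg V (card B * D)"
  using assms(2,3)
  by (induction B) (auto intro: polyfun_deg_one polyfun_deg_mult assms(1))

definition polyfun :: "'v set \<Rightarrow> (('v \<Rightarrow> complex) \<Rightarrow> complex) set" where
  "polyfun V = (\<Union>D. polyfun_deg V D)"

lemma polyfun_var:
  assumes "finite V" "v \<in> V"
  shows "(\<lambda>t. t v) \<in> polyfun V"
proof -
  have "(\<Prod>w\<in>V. t w ^ (if w = v then 1 else 0)) = t v" for t :: "'a \<Rightarrow> complex"
    using assms by (simp add: if_distrib[of "\<lambda>n. _ ^ n"] cong: if_cong)
  then show ?thesis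
    using polyfun_deg_monomial[OF assms(1), of "\<lambda>w. if w = v then 1 else 0" 1]
    unfolding polyfun_def by (auto intro!: exI[of _ 1])
qed

lemma polyfun_const: "finite V \<Longrightarrow> (\<lambda>t. a) \<in> polyfun V"
  using polyfun_deg_cmult[OF polyfun_deg_one, of V a 0] by (auto simp: polyfun_def)

lemma polyfun_add:
  assumes "finite V" "f \<in> polyfun V" "g \<in> polyfun V"
  shows "(\<lambda>t. f t + g t) \<in> polyfun V"
proof -
  from assms obtain D D' where "f \<in> polyfun_deg V D" "g \<in> polyfun_deg V D'"
    by (auto simp: polyfun_def)
  then have "(\<lambda>t. f t + g t) \<in> polyfun_deg V (max D D')"
    using assms(1) by (intro polyfun_deg_add) (auto intro: polyfun_deg_mono)
  then show ?thesis by (auto simp: polyfun_def)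
qed

lemma polyfun_mult:
  assumes "finite V" "f \<in> polyfun V" "g \<in> polyfun V"
  shows "(\<lambda>t. f t * g t) \<in> polyfun V"
  using assms polyfun_deg_mult[OF assms(1)] by (fastforce simp: polyfun_def)

lemma polyfun_diff:
  assumes "finite V" "f \<in> polyfun V" "g \<in> polyfun V"
  shows "(\<lambda>t. f t - g t) \<in> polyfun V"
  using polyfun_add[OF assms(1,2) polyfun_mult[OF assms(1) polyfun_const[OF assms(1), of "-1"] assms(3)]]
  by simp

lemma polyfun_sum:
  assumes "finite V" "\<And>i. i \<in> A \<Longrightarrow> f i \<in> polyfun V"
  shows "(\<lambda>t. \<Sum>i\<in>A. f i t) \<in> polyfun V"
  using assms(2)
  by (induction A rule: infinite_finite_induct) (auto intro: polyfun_const polyfun_add assms(1))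

section \<open>Algebraic dependence by counting monomials\<close>

text \<open>The products of powers of the \<open>f b\<close> lie in the span of the monomials in
  \<open>V\<close>. For large \<open>D\<close> there are more products than monomials, which forces
  a linear relation.\<close>

lemma polyfun_algebraically_dependent:
  assumes V: "finite V" and B: "finite B" and card: "card V < card B"
    and f: "\<And>b. b \<in> B \<Longrightarrow> f b \<in> polyfun V"
  obtains D c where "\<exists>e\<in>PiE B (\<lambda>_. {..D}). c e \<noteq> (0::complex)"
    "\<And>t. (\<Sum>e\<in>PiE B (\<lambda>_. {..D}). c e * (\<Prod>b\<in>B. f b t ^ e b)) = 0"
proof -
  from f have "\<forall>b\<in>B. \<exists>E. f b \<in> polyfun_deg V E" by (auto simp: polyfun_def)
  then obtain E where E: "\<And>b. b \<in> B \<Longrightarrow> f b \<in> polyfun_deg V (E b)" by metis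
  \<comment> \<open>Adding 1 ensures \<open>K \<ge> 1\<close> even for constant \<open>f b\<close>,
    as needed for \<open>K * D + 1 \<le> K * (D + 1)\<close>.\<close>
  define E0 where "E0 = Max (E ` B) + 1"
  have fE: "f b \<in> polyfun_deg V E0" if "b \<in> B" for b
    using B that by (intro polyfun_deg_mono[OF V E[OF that]]) (simp add: E0_def le_SucI)
  define K where "K = card B * E0"
  have K: "K \<ge> 1" using card by (auto simp: K_def E0_def)
  define D where "D = K ^ card V"
  have "\<forall>e\<in>PiE B (\<lambda>_. {..D}). (\<lambda>t. \<Prod>b\<in>B. f b t ^ e b) \<in> polyfun_deg V (K * D)"
  proof
    fix e assume "e \<in> PiE B (\<lambda>_. {..D})"
    then have "(\<lambda>t. f b t ^ e b) \<in> polyfun_deg V (E0 * D)" if "b \<in> B" for b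
      using that fE[OF that]
      by (intro polyfun_deg_mono[OF V polyfun_deg_power[OF V]]) (auto simp: mult.commute PiE_iff)
    from polyfun_deg_prod[OF V B this] show "(\<lambda>t. \<Prod>b\<in>B. f b t ^ e b) \<in> polyfun_deg V (K * D)"
      by (simp add: K_def mult.assoc)
  qed
  then have "\<exists>C. \<forall>e\<in>PiE B (\<lambda>_. {..D}). \<forall>t. (\<Prod>b\<in>B. f b t ^ e b) =
      (\<Sum>e'\<in>PiE V (\<lambda>_. {..K * D}). C e e' * (\<Prod>v\<in>V. t v ^ e' v))"
    unfolding polyfun_deg_def mem_Collect_eq by (rule bchoice)
  then obtain C where C: "\<And>e t. e \<in> PiE B (\<lambda>_. {..D}) \<Longrightarrow>
      (\<Prod>b\<in>B. f b t ^ e b) = (\<Sum>e'\<in>PiE V (\<lambda>_. {..K * D}). C e e' * (\<Prod>v\<in>V. t v ^ e' v))"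
    by blast
  txt \<open>\<open>D\<close> is chosen such that \<open>(K D + 1)\<^bsup>card V\<^esup> < (D + 1)\<^bsup>card B\<^esup>\<close>.\<close>
  have "card (PiE V (\<lambda>_. {..K * D})) = (K * D + 1) ^ card V"
    using V by (simp add: card_PiE)
  also have "\<dots> \<le> (K * (D + 1)) ^ card V"
    using K by (intro power_mono) auto
  \<comment> \<open>\<open>D\<close> was defined as the factor \<open>K ^ card V\<close> that splits
    off here.\<close>
  also have "\<dots> = D * (D + 1) ^ card V"
    by (simp only: D_def power_mult_distrib)
  also have "\<dots> < (D + 1) ^ (card V + 1)" by simp
  also have "\<dots> \<le> (D + 1) ^ card B"
    using card by (intro power_increasing) auto
  also have "\<dots> = card (PiE B (\<lambda>_. {..D}))"
    using B by (simp add: card_PiE)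
  finally obtain c where c: "\<exists>e\<in>PiE B (\<lambda>_. {..D}). c e \<noteq> 0"
      "\<And>e'. e' \<in> PiE V (\<lambda>_. {..K * D}) \<Longrightarrow> (\<Sum>e\<in>PiE B (\<lambda>_. {..D}). c e * C e e') = 0"
    using homogeneous_system_nontrivial_solution[of "PiE V (\<lambda>_. {..K * D})" "PiE B (\<lambda>_. {..D})" C]
      V B by (auto simp: finite_PiE)
  have "(\<Sum>e\<in>PiE B (\<lambda>_. {..D}). c e * (\<Prod>b\<in>B. f b t ^ e b)) = 0" for t
  proof -
    have "(\<Sum>e\<in>PiE B (\<lambda>_. {..D}). c e * (\<Prod>b\<in>B. f b t ^ e b)) =
      (\<Sum>e\<in>PiE B (\<lambda>_. {..D}). \<Sum>e'\<in>PiE V (\<lambda>_. {..K * D}). c e * C e e' * (\<Prod>v\<in>V. t v ^ e' v))"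
      by (intro sum.cong) (auto simp: C sum_distrib_left mult.assoc)
    also have "\<dots> = (\<Sum>e'\<in>PiE V (\<lambda>_. {..K * D}).
        (\<Sum>e\<in>PiE B (\<lambda>_. {..D}). c e * C e e') * (\<Prod>v\<in>V. t v ^ e' v))"
      by (subst sum.swap) (simp add: sum_distrib_right)
    also have "\<dots> = 0" by (simp add: c(2))
    finally show ?thesis .
  qed
  with c(1) that show ?thesis by blast
qed

section \<open>Zero sets of nonzero polynomials are null\<close>

text \<open>Induction on the variables with Tonelli: for almost all values of the other variables,
  some coefficient with respect to the new variable is nonzero, leaving finitely many roots.\<close>

lemma AE_PiM_polynomial_nonzero:
  fixes c :: "('i \<Rightarrow> nat) \<Rightarrow> complex"
  assumes "finite I" "e0 \<in> PiE I (\<lambda>_. {..D})" "c e0 \<noteq> 0"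
  shows "AE x in PiM I (\<lambda>_. lborel).
           (\<Sum>e\<in>PiE I (\<lambda>_. {..D}). c e * (\<Prod>i\<in>I. complex_of_real (x i) ^ e i)) \<noteq> 0"
  using assms
proof (induction I arbitrary: c e0 rule: finite_induct)
  case empty
  then show ?case by (simp add: PiE_empty_domain)
next
  case (insert i I)
  interpret product_sigma_finite "\<lambda>_::'i. lborel :: real measure" ..
  let ?M = "\<lambda>I. PiM I (\<lambda>_::'i. lborel :: real measure)"
  define Q where "Q x = (\<Sum>e\<in>PiE (insert i I) (\<lambda>_. {..D}). c e * (\<Prod>j\<in>insert i I. complex_of_real (x j) ^ e j))" for x
  define q where "q n y = (\<Sum>e\<in>PiE I (\<lambda>_. {..D}). c (e(i := n)) * (\<Prod>j\<in>I. complex_of_real (y j) ^ e j))" for n y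
  have Q_eq: "Q (y(i := t)) = (\<Sum>n\<le>D. q n y * complex_of_real t ^ n)" for y t
  proof -
    have "inj_on (\<lambda>(n, e). e(i := n)) ({..D} \<times> PiE I (\<lambda>_. {..D}))"
      using inj_combinator[OF insert.hyps(2), of "\<lambda>_. {..D}"] by simp
    then have "Q (y(i := t)) = (\<Sum>(n, e)\<in>{..D} \<times> PiE I (\<lambda>_. {..D}).
        c (e(i := n)) * (\<Prod>j\<in>insert i I. complex_of_real ((y(i := t)) j) ^ (e(i := n)) j))"
      unfolding Q_def PiE_insert_eq by (subst sum.reindex) (auto simp: case_prod_beta o_def)
    also have "\<dots> = (\<Sum>(n, e)\<in>{..D} \<times> PiE I (\<lambda>_. {..D}).
        c (e(i := n)) * (\<Prod>j\<in>I. complex_of_real (y j) ^ e j) * complex_of_real t ^ n)"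
    proof (intro sum.cong refl, clarify)
      fix n e
      have "(\<Prod>j\<in>I. complex_of_real ((y(i := t)) j) ^ (e(i := n)) j) = (\<Prod>j\<in>I. complex_of_real (y j) ^ e j)"
        using insert.hyps by (intro prod.cong) auto
      then show "c (e(i := n)) * (\<Prod>j\<in>insert i I. complex_of_real ((y(i := t)) j) ^ (e(i := n)) j) =
        c (e(i := n)) * (\<Prod>j\<in>I. complex_of_real (y j) ^ e j) * complex_of_real t ^ n"
        using insert.hyps by (simp add: mult_ac)
    qed
    also have "\<dots> = (\<Sum>n\<le>D. q n y * complex_of_real t ^ n)"
      by (simp add: q_def sum_distrib_right sum.cartesian_product)
    finally show ?thesis .
  qed
  \<comment> \<open>Exponent functions are extensional, so one on \<open>I\<close> must be
    \<open>undefined\<close> at \<open>i\<close>.\<close>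
  have e0: "e0 i \<le> D" "e0(i := undefined) \<in> PiE I (\<lambda>_. {..D})"
    using insert.prems(1) insert.hyps(2) by (auto simp: PiE_iff extensional_def)
  \<comment> \<open>The coefficient of the power \<open>e0 i\<close> is a polynomial in the
    remaining variables, in which \<open>c e0\<close> is a nonzero coefficient.\<close>
  have "AE y in ?M I. q (e0 i) y \<noteq> 0"
    using insert.IH[of "e0(i := undefined)" "\<lambda>e. c (e(i := e0 i))"] e0 insert.prems(2)
    unfolding q_def by (simp add: fun_upd_triv del: fun_upd_apply)
  then have inner: "AE y in ?M I. (\<integral>\<^sup>+ t. (if Q (y(i := t)) = 0 then 1 else 0) \<partial>lborel) = 0"
  proof eventually_elim
    case (elim y)
    have "finite {z. (\<Sum>n\<le>D. q n y * z ^ n) = 0}"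
      using polyfun_finite_roots[of "\<lambda>n. q n y" D] elim e0(1) by auto
    then have "finite (complex_of_real -` {z. (\<Sum>n\<le>D. q n y * z ^ n) = 0})"
      by (intro finite_vimageI) (auto simp: inj_on_def)
    then have fin: "finite {t. Q (y(i := t)) = 0}"
      by (simp add: Q_eq vimage_def)
    have "(\<integral>\<^sup>+ t. (if Q (y(i := t)) = 0 then 1 else 0) \<partial>lborel)
        = (\<integral>\<^sup>+ t. indicator {t. Q (y(i := t)) = 0} t \<partial>lborel)"
      by (intro nn_integral_cong) (auto simp: indicator_def)
    also have "\<dots> = emeasure lborel {t. Q (y(i := t)) = 0}"
      using fin by (intro nn_integral_indicator) (auto intro: borel_closed finite_imp_closed)
    also have "\<dots> = 0"
      using fin by (intro emeasure_lborel_countable) (rule countable_finite)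
    finally show ?case .
  qed
  have [measurable]: "Q \<in> borel_measurable (?M (insert i I))"
    unfolding Q_def by measurable
  have meas: "{x \<in> space (?M (insert i I)). Q x = 0} \<in> sets (?M (insert i I))"
    by measurable
  have "emeasure (?M (insert i I)) {x \<in> space (?M (insert i I)). Q x = 0}
      = (\<integral>\<^sup>+ x. (if Q x = 0 then 1 else 0) \<partial>?M (insert i I))"
    unfolding nn_integral_indicator[OF meas, symmetric] by (intro nn_integral_cong) simp
  also have "\<dots> = (\<integral>\<^sup>+ y. (\<integral>\<^sup>+ t. (if Q (y(i := t)) = 0 then 1 else 0) \<partial>lborel) \<partial>?M I)"
    using insert.hyps by (intro product_nn_integral_insert) measurable
  also have "\<dots> = 0"
    using inner by (simp add: nn_integral_0_iff_AE nn_integral_cong_AE)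
  finally have "AE x in ?M (insert i I). Q x \<noteq> 0"
    using meas by (intro AE_I[where N="{x \<in> space (?M (insert i I)). Q x = 0}"]) auto
  then show ?case unfolding Q_def .
qed


text \<open>In coordinates with respect to \<open>Basis\<close>, \<open>lborel\<close> is a product
  measure, so the previous lemma applies.\<close>

lemma polynomial_zero_set_closed_null:
  fixes c :: "('a::euclidean_space \<Rightarrow> nat) \<Rightarrow> complex"
  assumes "e0 \<in> PiE Basis (\<lambda>_. {..D})" "c e0 \<noteq> 0"
  defines "Z \<equiv> {x::'a. (\<Sum>e\<in>PiE Basis (\<lambda>_. {..D}). c e * (\<Prod>b\<in>Basis. complex_of_real (x \<bullet> b) ^ e b)) = 0}"
  shows "closed Z" "Z \<in> null_sets lborel"
proof -
  show cl: "closed Z"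
    unfolding Z_def by (intro closed_Collect_eq continuous_intros)
  have [measurable]: "Z \<in> sets borel" using cl by (rule borel_closed)
  have "AE x in lborel. x \<notin> Z"
  proof (subst lborel_eq, subst AE_distr_iff)
    show "AE f in PiM Basis (\<lambda>_. lborel). (\<Sum>b\<in>Basis. f b *\<^sub>R b) \<notin> Z"
      using AE_PiM_polynomial_nonzero[where c=c and ?e0.0=e0, OF finite_Basis assms(1,2)]
      by (simp add: Z_def)
  qed measurable
  then show "Z \<in> null_sets lborel"
    by (simp add: AE_iff_null_sets)
qed


text \<open>An algebraic relation among the \<open>f b\<close> vanishes on the whole image, and
  \<open>Z\<close> is its zero set. The parameters \<open>t\<close> may be complex although the
  points are real: only their number enters.\<close>

lemma polyfun_image_in_closed_null:
  fixes f :: "'a::euclidean_space \<Rightarrow> ('v \<Rightarrow> complex) \<Rightarrow> complex"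
  assumes V: "finite V" "card V < DIM('a)" and f: "\<And>b. b \<in> Basis \<Longrightarrow> f b \<in> polyfun V"
  shows "\<exists>Z. closed Z \<and> Z \<in> null_sets lborel \<and>
    {x. \<exists>t. \<forall>b\<in>Basis. complex_of_real (x \<bullet> b) = f b t} \<subseteq> Z"
proof -
  obtain D c where c: "\<exists>e\<in>PiE Basis (\<lambda>_. {..D}). c e \<noteq> (0::complex)"
    "\<And>t. (\<Sum>e\<in>PiE Basis (\<lambda>_. {..D}). c e * (\<Prod>b\<in>Basis. f b t ^ e b)) = 0"
    using polyfun_algebraically_dependent[where f=f, OF V(1) finite_Basis V(2) f] by blast
  from c(1) obtain e0 where e0: "e0 \<in> PiE Basis (\<lambda>_. {..D})" "c e0 \<noteq> 0" by blast
  let ?Z = "{x::'a. (\<Sum>e\<in>PiE Basis (\<lambda>_. {..D}). c e * (\<Prod>b\<in>Basis. complex_of_real (x \<bullet> b) ^ e b)) = 0}"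
  have "x \<in> ?Z" if "\<forall>b\<in>Basis. complex_of_real (x \<bullet> b) = f b t" for x t
    using c(2)[of t] that by simp
  then show ?thesis
    using polynomial_zero_set_closed_null[where c=c, OF e0] by (intro exI[of _ ?Z]) blast
qed

text \<open>A null set has empty interior, hence a dense complement.\<close>

lemma generic_if_bad_in_closed_null:
  assumes "closed Z" "Z \<in> null_sets lborel" "\<And>z. z \<notin> Z \<Longrightarrow> P z"
  shows "generic P"
proof -
  have "negligible Z"
    using assms(2) by (simp add: negligible_iff_null_sets null_sets_completionI)
  then have "negligible (interior Z)"
    by (rule negligible_subset) (rule interior_subset)
  then have "interior Z = {}"
    using open_not_negligible by blast
  then have "closure (- Z) = UNIV"
    by (simp add: closure_complement)
  with assms show ?thesis
    unfolding generic_def by (intro exI[of _ "- Z"]) (auto simp: Compl_eq_Diff_UNIV[symmetric] double_diff)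
qed

section \<open>Polynomial parametrization of collisions\<close>

text \<open>
  The exceptional case \<open>u = v\<close> is a value of the discrete parameter \<open>e\<close>, which keeps the
  parametrization polynomial in \<open>c\<close> and \<open>r\<close> without spending a fourth real dimension.
\<close>
lemma equal_norm_parametrization:
  assumes "cmod u = cmod v"
  shows "\<exists>c (r::real) e. u = c * (of_real r + (if e then \<i> else 0)) \<and>
                         v = c * (of_real r - (if e then \<i> else 0))"
proof (cases "u = v")
  case True
  then show ?thesis by (intro exI[of _ u] exI[of _ 1] exI[of _ False]) simp
next
  case False
  \<comment> \<open>Solves \<open>u / v = (w + \<i>) / (w - \<i>)\<close>: an inverse Cayley
    transform, real because \<open>u / v\<close> lies on the unit circle.\<close>
  define w where "w = \<i> * (u + v) / (u - v)"
  have "u * cnj u = v * cnj v"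
    using assms by (simp add: complex_norm_square[symmetric])
  then have "- \<i> * (cnj u + cnj v) * (u - v) = \<i> * (u + v) * (cnj u - cnj v)"
    by algebra
  moreover have "cnj u - cnj v \<noteq> 0" using False by (metis complex_cnj_cancel_iff right_minus_eq)
  ultimately have "(- \<i> * (cnj u + cnj v)) / (cnj u - cnj v) = (\<i> * (u + v)) / (u - v)"
    using False by (subst frac_eq_eq) auto
  then have "cnj w = w"
    by (simp add: w_def)
  then have w: "complex_of_real (Re w) = w"
    by (metis Reals_cnj_iff of_real_Re)
  define c where "c = (u - v) / (2 * \<i>)"
  have "u = c * (w + \<i>)" "v = c * (w - \<i>)"
    using False by (simp_all add: c_def w_def field_simps)
  with w show ?thesis
    by (intro exI[of _ c] exI[of _ "Re w"] exI[of _ True]) simp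
qed

text \<open>
  Coordinates of a collision \<open>|u\<^sub>j| = |v\<^sub>j|\<close>, where \<open>u\<^sub>j = \<langle>a\<^sub>j, x\<rangle> + b\<^sub>j\<close>, \<open>v\<^sub>j = \<langle>a\<^sub>j, y\<rangle> + b\<^sub>j\<close>
  and \<open>x\<^sub>k \<noteq> y\<^sub>k\<close>. A quantity and its conjugate are independent variables, the Boolean flag
  selecting the conjugate: \<open>PX\<close> and \<open>PY\<close> are the entries of \<open>x\<close> and \<open>y\<close>, \<open>PZ\<close> is
  \<open>1 / (x\<^sub>k - y\<^sub>k)\<close>, \<open>PC\<close> and \<open>PT\<close> are \<open>c\<close> and \<open>r\<close> of \<open>equal_norm_parametrization\<close>, and \<open>PA\<close>
  holds the entries of \<open>A\<close>, which occur unconjugated for the flag \<open>True\<close> because the inner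
  product conjugates its first argument. The equation \<open>\<langle>a\<^sub>j, x - y\<rangle> = u\<^sub>j - v\<^sub>j\<close> determines the
  \<open>k\<close>-th entry of \<open>a\<^sub>j\<close>, and then \<open>b\<^sub>j = v\<^sub>j - \<langle>a\<^sub>j, y\<rangle>\<close>; so neither \<open>x\<^sub>k\<close> nor the column \<open>k\<close>
  of \<open>A\<close> is a variable.
\<close>
datatype ('d, 'm) param =
  PX bool 'd | PY bool 'd | PZ bool | PC bool 'm | PT 'm | PA bool 'm 'd

text \<open>Entries outside the support \<open>I\<close> are the constant 0 and cost no
  variable.\<close>

definition restr :: "'d set \<Rightarrow> (bool \<Rightarrow> 'd \<Rightarrow> ('d, 'm) param) \<Rightarrow> bool \<Rightarrow> 'd \<Rightarrow> (('d, 'm) param \<Rightarrow> complex) \<Rightarrow> complex" where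
  "restr I X s i t = (if i \<in> I then t (X s i) else 0)"

text \<open>The imaginary term of \<open>equal_norm_parametrization\<close>, conjugated for the flag
  \<open>True\<close>.\<close>

definition shift :: "('m \<Rightarrow> bool) \<Rightarrow> bool \<Rightarrow> 'm \<Rightarrow> complex" where
  "shift \<epsilon> s j = (if \<epsilon> j then if s then - \<i> else \<i> else 0)"

definition entry :: "'d::finite \<Rightarrow> 'd set \<Rightarrow> 'd set \<Rightarrow> ('m \<Rightarrow> bool) \<Rightarrow> bool \<Rightarrow> 'm \<Rightarrow> 'd
    \<Rightarrow> (('d, 'm) param \<Rightarrow> complex) \<Rightarrow> complex" where
  "entry k I J \<epsilon> s j i t =
    (if i = k
     then t (PZ s) * (t (PC s j) * (t (PT j) + shift \<epsilon> s j) - t (PC s j) * (t (PT j) - shift \<epsilon> s j)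
            - (\<Sum>l\<in>UNIV - {k}. t (PA s j l) * (restr I PX s l t - restr J PY s l t)))
     else t (PA s j i))"

definition offset :: "'d::finite \<Rightarrow> 'd set \<Rightarrow> 'd set \<Rightarrow> ('m \<Rightarrow> bool) \<Rightarrow> bool \<Rightarrow> 'm
    \<Rightarrow> (('d, 'm) param \<Rightarrow> complex) \<Rightarrow> complex" where
  "offset k I J \<epsilon> s j t =
    t (PC s j) * (t (PT j) - shift \<epsilon> s j) - (\<Sum>i\<in>UNIV. entry k I J \<epsilon> s j i t * restr J PY s i t)"

definition param_vars :: "'d::finite \<Rightarrow> 'd set \<Rightarrow> 'd set \<Rightarrow> ('d, 'm::finite) param set" where
  "param_vars k I J =
    (\<lambda>(s, i). PX s i) ` (UNIV \<times> (I - {k})) \<union> (\<lambda>(s, i). PY s i) ` (UNIV \<times> J) \<union> range PZ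
    \<union> (\<lambda>(s, j). PC s j) ` UNIV \<union> range PT \<union> (\<lambda>(s, j, i). PA s j i) ` (UNIV \<times> UNIV \<times> (UNIV - {k}))"

lemma finite_param_vars: "finite (param_vars k I J)"
  unfolding param_vars_def by auto

text \<open>\<open>PX\<close> and \<open>PZ\<close> together give \<open>2 * card I\<close> and
  \<open>PY\<close> gives \<open>2 * card J\<close>. A row has 2 variables for \<open>c\<close>, 2
  for each column other than \<open>k\<close>, and only 1 for \<open>r\<close>, which is its own
  conjugate.\<close>

lemma card_param_vars:
  assumes "k \<in> I" "card I \<le> s" "card J \<le> s"
  shows "card (param_vars k I J :: ('d::finite, 'm::finite) param set)
    \<le> 4 * s + CARD('m) * (2 * CARD('d) + 1)"
proof -
  let ?X = "(\<lambda>(s, i). PX s i) ` (UNIV \<times> (I - {k})) :: ('d, 'm) param set"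
  let ?Y = "(\<lambda>(s, i). PY s i) ` (UNIV \<times> J) :: ('d, 'm) param set"
  let ?Z = "range PZ :: ('d, 'm) param set"
  let ?C = "(\<lambda>(s, j). PC s j) ` UNIV :: ('d, 'm) param set"
  let ?T = "range PT :: ('d, 'm) param set"
  let ?A = "(\<lambda>(s, j, i). PA s j i) ` (UNIV \<times> UNIV \<times> (UNIV - {k})) :: ('d, 'm) param set"
  have "card ?X \<le> 2 * (card I - 1)"
    by (rule order_trans[OF card_image_le]) (use assms(1) in \<open>auto simp: card_cartesian_product\<close>)
  moreover have "card ?Y \<le> 2 * card J"
    by (rule order_trans[OF card_image_le]) (auto simp: card_cartesian_product)
  moreover have "card ?Z \<le> 2"
    by (rule order_trans[OF card_image_le]) auto
  moreover have "card ?C \<le> 2 * CARD('m)"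
    by (rule order_trans[OF card_image_le]) (auto simp: card_cartesian_product simp flip: UNIV_Times_UNIV)
  moreover have "card ?T \<le> CARD('m)"
    by (rule card_image_le) auto
  moreover have "card ?A \<le> 2 * (CARD('m) * (CARD('d) - 1))"
    by (rule order_trans[OF card_image_le]) (auto simp: card_cartesian_product)
  moreover have "card (param_vars k I J :: ('d, 'm) param set)
      \<le> card ?X + card ?Y + card ?Z + card ?C + card ?T + card ?A"
    unfolding param_vars_def by (intro order_trans[OF card_Un_le] add_mono order_refl)
  \<comment> \<open>Excludes truncation in \<open>card I - 1\<close>.\<close>
  moreover have "card I \<ge> 1"
    using assms(1) by (simp add: card_gt_0_iff Suc_le_eq) auto
  moreover have "CARD('m) * (CARD('d) - 1) + CARD('m) = CARD('m) * CARD('d)"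
    by (metis One_nat_def Suc_pred add.commute mult_Suc_right zero_less_card_finite)
  moreover have "CARD('m) * (2 * CARD('d) + 1) = 2 * (CARD('m) * CARD('d)) + CARD('m)"
    by simp
  ultimately show ?thesis
    using assms(2,3) by linarith
qed

lemma param_vars_iff:
  "PX s i \<in> param_vars k I J \<longleftrightarrow> i \<in> I \<and> i \<noteq> k" "PY s i \<in> param_vars k I J \<longleftrightarrow> i \<in> J"
  "PZ s \<in> param_vars k I J" "PC s j \<in> param_vars k I J" "PT j \<in> param_vars k I J"
  "PA s j i \<in> param_vars k I J \<longleftrightarrow> i \<noteq> k"
  unfolding param_vars_def by (auto simp: image_iff)

lemma polyfun_entry: "entry k I J \<epsilon> s j i \<in> polyfun (param_vars k I J)"
proof -
  note F = finite_param_vars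
  have var: "p \<in> param_vars k I J \<Longrightarrow> (\<lambda>t. t p) \<in> polyfun (param_vars k I J)" for p
    by (rule polyfun_var[OF F])
  \<comment> \<open>\<open>PX s k\<close> is not among the variables, but \<open>entry\<close> sums
    only over \<open>l \<noteq> k\<close>.\<close>
  have x: "restr I PX s l \<in> polyfun (param_vars k I J)" if "l \<noteq> k" for l
    unfolding restr_def[abs_def] using that
    by (cases "l \<in> I") (auto intro: var polyfun_const[OF F] simp: param_vars_iff)
  have y: "restr J PY s l \<in> polyfun (param_vars k I J)" for l
    unfolding restr_def[abs_def]
    by (cases "l \<in> J") (auto intro: var polyfun_const[OF F] simp: param_vars_iff)
  show ?thesis
  proof (cases "i = k")
    case True
    show ?thesis
      unfolding entry_def[abs_def] if_P[OF True]
      by (intro polyfun_add[OF F] polyfun_mult[OF F] polyfun_diff[OF F] polyfun_sum[OF F]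
          polyfun_const[OF F] var x y) (auto simp: param_vars_iff)
  next
    case False
    then show ?thesis
      unfolding entry_def[abs_def] by (auto intro: var simp: param_vars_iff)
  qed
qed

lemma polyfun_offset: "offset k I J \<epsilon> s j \<in> polyfun (param_vars k I J)"
proof -
  note F = finite_param_vars
  have var: "p \<in> param_vars k I J \<Longrightarrow> (\<lambda>t. t p) \<in> polyfun (param_vars k I J)" for p
    by (rule polyfun_var[OF F])
  have y: "restr J PY s l \<in> polyfun (param_vars k I J)" for l
    unfolding restr_def[abs_def]
    by (cases "l \<in> J") (auto intro: var polyfun_const[OF F] simp: param_vars_iff)
  show ?thesis
    unfolding offset_def[abs_def]
    by (intro polyfun_add[OF F] polyfun_mult[OF F] polyfun_diff[OF F] polyfun_sum[OF F]
          polyfun_const[OF F] polyfun_entry var y) (auto simp: param_vars_iff)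
qed

text \<open>The values in \<open>t\<close> are arbitrary complex numbers, with no conjugacy imposed
  between the two flags. This may enlarge the set beyond actual collisions, which is harmless since
  it only has to contain them.\<close>

definition collision_set :: "'d::finite \<times> 'd set \<times> 'd set \<times> ('m::finite \<Rightarrow> bool) \<Rightarrow> ((complex^'d^'m) \<times> (complex^'m)) set" where
  "collision_set = (\<lambda>(k, I, J, \<epsilon>). {(A, b). \<exists>t. \<forall>j.
     (\<forall>i. entry k I J \<epsilon> False j i t = cnj (A $ j $ i) \<and> entry k I J \<epsilon> True j i t = A $ j $ i) \<and>
     offset k I J \<epsilon> False j t = b $ j \<and> offset k I J \<epsilon> True j t = cnj (b $ j)})"

lemma collision_parametrized:
  fixes A :: "complex^'d^'m" and b :: "complex^'m"
  assumes eq: "meas A b x = meas A b y" and k: "x $ k \<noteq> y $ k"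
  defines "I \<equiv> {i. x $ i \<noteq> 0}" and "J \<equiv> {i. y $ i \<noteq> 0}"
  shows "\<exists>\<epsilon>. (A, b) \<in> collision_set (k, I, J, \<epsilon>)"
proof -
  define u where "u j = cinner (A $ j) x + b $ j" for j
  define v where "v j = cinner (A $ j) y + b $ j" for j
  have "cmod (u j) = cmod (v j)" for j
    using arg_cong[OF eq, of "\<lambda>w. w $ j"] by (simp add: meas_def u_def v_def)
  then have "\<forall>j. \<exists>c (r::real) e. u j = c * (of_real r + (if e then \<i> else 0)) \<and>
                         v j = c * (of_real r - (if e then \<i> else 0))"
    by (intro allI equal_norm_parametrization)
  then obtain c r \<epsilon> where uv:
    "\<And>j. u j = c j * (complex_of_real (r j) + (if \<epsilon> j then \<i> else 0))"
    "\<And>j. v j = c j * (complex_of_real (r j) - (if \<epsilon> j then \<i> else 0))"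
    by metis
  \<comment> \<open>Both choices of \<open>cj s\<close> respect the field operations, so each
    identity below is proved once and transferred to both flags.\<close>
  define cj where "cj s z = (if s then cnj z else z)" for s z
  have cj: "cj s (z + w) = cj s z + cj s w" "cj s (z - w) = cj s z - cj s w"
    "cj s (z * w) = cj s z * cj s w" "cj s (inverse z) = inverse (cj s z)" "cj s 0 = 0"
    "cj s (complex_of_real a) = complex_of_real a"
    "cj s (if \<epsilon> j then \<i> else 0) = shift \<epsilon> s j" for s z w a j
    by (auto simp: cj_def shift_def)
  have cj_sum: "cj s (sum f S) = (\<Sum>i\<in>S. cj s (f i))" for s and f :: "'d \<Rightarrow> complex" and S
    by (simp add: cj_def)
  define t where "t p = (case p of PX s i \<Rightarrow> cj s (x $ i) | PY s i \<Rightarrow> cj s (y $ i)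
    | PZ s \<Rightarrow> cj s (inverse (x $ k - y $ k)) | PC s j \<Rightarrow> cj s (c j) | PT j \<Rightarrow> complex_of_real (r j)
    | PA s j i \<Rightarrow> cj s (cnj (A $ j $ i)))" for p
  have t: "restr I PX s i t = cj s (x $ i)" "restr J PY s i t = cj s (y $ i)"
    "t (PZ s) = cj s (inverse (x $ k - y $ k))" "t (PA s j i) = cj s (cnj (A $ j $ i))"
    "t (PC s j) * (t (PT j) + shift \<epsilon> s j) = cj s (u j)"
    "t (PC s j) * (t (PT j) - shift \<epsilon> s j) = cj s (v j)" for s j i
    by (auto simp: t_def restr_def I_def J_def uv cj)
  have entry: "entry k I J \<epsilon> s j i t = cj s (cnj (A $ j $ i))" for s j i
  proof (cases "i = k")
    case True
    have "u j - v j = (\<Sum>l\<in>UNIV. cnj (A $ j $ l) * (x $ l - y $ l))"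
      by (simp add: u_def v_def cinner_def right_diff_distrib sum_subtractf)
    also have "\<dots> = cnj (A $ j $ k) * (x $ k - y $ k)
        + (\<Sum>l\<in>UNIV - {k}. cnj (A $ j $ l) * (x $ l - y $ l))"
      by (rule sum.remove) auto
    finally have "inverse (x $ k - y $ k) * (u j - v j
        - (\<Sum>l\<in>UNIV - {k}. cnj (A $ j $ l) * (x $ l - y $ l))) = cnj (A $ j $ k)"
      using k by (simp add: field_simps)
    from arg_cong[OF this, of "cj s"] show ?thesis
      using True by (simp only: entry_def t cj cj_sum if_True refl)
  next
    case False
    then show ?thesis by (simp add: entry_def t)
  qed
  have offset: "offset k I J \<epsilon> s j t = cj s (b $ j)" for s j
  proof -
    have "v j - (\<Sum>i\<in>UNIV. cnj (A $ j $ i) * y $ i) = b $ j"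
      by (simp add: v_def cinner_def)
    from arg_cong[OF this, of "cj s"] show ?thesis
      by (simp only: offset_def entry t cj cj_sum)
  qed
  show ?thesis
    unfolding collision_set_def
    by (auto intro!: exI[of _ \<epsilon>] exI[of _ t] simp: entry offset cj_def)
qed

section \<open>Null collision sets and genericity\<close>

text \<open>Makes real coordinates polynomial in a complex entry and its conjugate.\<close>

lemma complex_inner_eq: "complex_of_real (z \<bullet> w) = (cnj z * w + z * cnj w) / 2"
  by (simp add: complex_eq_iff inner_complex_def)

lemma collision_set_in_closed_null:
  fixes k :: "'d::finite" and \<epsilon> :: "'m::finite \<Rightarrow> bool"
  assumes m: "CARD('m) \<ge> 4 * s + 1" and I: "k \<in> I" "card I \<le> s" "card J \<le> s"
  shows "\<exists>Z. closed Z \<and> Z \<in> null_sets lborel \<and> collision_set (k, I, J, \<epsilon>) \<subseteq> Z"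
proof -
  \<comment> \<open>The real inner product of \<open>(A, b)\<close> with \<open>P\<close> in terms
    of the parameters. The flags swap between the two sums because \<open>entry\<close> is
    conjugated for \<open>False\<close> and \<open>offset\<close> for \<open>True\<close>.\<close>
  define f where "f P t =
      (\<Sum>j\<in>UNIV. \<Sum>i\<in>UNIV. (1/2) * (entry k I J \<epsilon> False j i t * fst P $ j $ i + entry k I J \<epsilon> True j i t * cnj (fst P $ j $ i)))
    + (\<Sum>j\<in>UNIV. (1/2) * (offset k I J \<epsilon> True j t * snd P $ j + offset k I J \<epsilon> False j t * cnj (snd P $ j)))"
    for P :: "(complex^'d^'m) \<times> (complex^'m)" and t
  note F = finite_param_vars
  have f: "f P \<in> polyfun (param_vars k I J)" for P
    unfolding f_def
    by (intro polyfun_add[OF F] polyfun_mult[OF F] polyfun_sum[OF F] polyfun_const[OF F]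
        polyfun_entry polyfun_offset)
  \<comment> \<open>The real dimension is \<open>CARD('m) * (2 * CARD('d) + 2)\<close>, so the
    inequality amounts to \<open>4 * s < CARD('m)\<close>.\<close>
  have card: "card (param_vars k I J :: ('d, 'm) param set) < DIM((complex^'d^'m) \<times> (complex^'m))"
    using card_param_vars[where 'm='m, OF I] m by (simp add: algebra_simps)
  have "collision_set (k, I, J, \<epsilon>) \<subseteq> {x. \<exists>t. \<forall>P\<in>Basis. complex_of_real (x \<bullet> P) = f P t}"
  proof (clarify, goal_cases)
    case (1 A b)
    then obtain t where h: "\<And>j i. entry k I J \<epsilon> False j i t = cnj (A $ j $ i)"
      "\<And>j i. entry k I J \<epsilon> True j i t = A $ j $ i"
      "\<And>j. offset k I J \<epsilon> False j t = b $ j" "\<And>j. offset k I J \<epsilon> True j t = cnj (b $ j)"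
      unfolding collision_set_def by auto
    have "complex_of_real ((A, b) \<bullet> P) = f P t" for P
      by (simp add: f_def h inner_prod_def inner_vec_def complex_inner_eq)
    then show ?case by blast
  qed
  with polyfun_image_in_closed_null[where f=f, OF F card f] show ?thesis
    by (meson order_trans)
qed

theorem theorem3p6:
  fixes s :: nat
  assumes "CARD('m::finite) \<ge> 4 * s + 1"
  shows "generic (\<lambda>(A :: complex^'d::finite^'m, b :: complex^'m).
           sparse_affine_pr s A b)"
proof -
  let ?S = "{(k::'d, I, J, \<epsilon>::'m \<Rightarrow> bool). k \<in> I \<and> card I \<le> s \<and> card J \<le> s}"
  have "\<forall>q\<in>?S. \<exists>Z. closed Z \<and> Z \<in> null_sets lborel \<and> collision_set q \<subseteq> Z"
    using collision_set_in_closed_null[OF assms] by auto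
  then obtain Z where Z: "\<forall>q\<in>?S. closed (Z q) \<and> Z q \<in> null_sets lborel \<and> collision_set q \<subseteq> Z q"
    by (rule bchoice[THEN exE])
  show ?thesis
  proof (rule generic_if_bad_in_closed_null)
    let ?Z = "\<Union>q\<in>?S. Z q"
    show "closed ?Z" using Z by (intro closed_UN) auto
    show "?Z \<in> null_sets lborel" using Z by (intro null_sets_UN') (auto intro: countable_finite)
    fix p :: "(complex^'d^'m) \<times> (complex^'m)"
    assume p: "p \<notin> ?Z"
    obtain A b where Ab: "p = (A, b)" by (cases p)
    \<comment> \<open>With \<open>k\<close> in the support of \<open>x\<close>, the pair
      \<open>PZ\<close> replaces the omitted \<open>PX s k\<close>; otherwise it would add two
      variables to the count.\<close>
    have no_collision: "meas A b x \<noteq> meas A b y"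
      if sp: "x \<in> sparse_vecs s" "y \<in> sparse_vecs s" and k: "x $ k \<noteq> y $ k" "x $ k \<noteq> 0" for x y k
    proof
      assume "meas A b x = meas A b y"
      from collision_parametrized[OF this k(1)] obtain \<epsilon> where
        "(A, b) \<in> collision_set (k, {i. x $ i \<noteq> 0}, {i. y $ i \<noteq> 0}, \<epsilon>)" ..
      moreover have "(k, {i. x $ i \<noteq> 0}, {i. y $ i \<noteq> 0}, \<epsilon>) \<in> ?S"
        using sp k by (simp add: sparse_vecs_def)
      ultimately have "(A, b) \<in> ?Z" using Z by (meson UN_I subsetD)
      with p Ab show False by metis
    qed
    have "x = y" if "x \<in> sparse_vecs s" "y \<in> sparse_vecs s" "meas A b x = meas A b y" for x y
    proof (rule ccontr)
      assume "x \<noteq> y"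
      then obtain k where "x $ k \<noteq> y $ k" by (auto simp: vec_eq_iff)
      \<comment> \<open>A coordinate where \<open>x\<close> and \<open>y\<close> differ lies in the
        support of one of them, and the collision is symmetric.\<close>
      show False
      proof (cases "x $ k = 0")
        case True
        with \<open>x $ k \<noteq> y $ k\<close> have "y $ k \<noteq> 0" by simp
        from no_collision[OF that(2,1) \<open>x $ k \<noteq> y $ k\<close>[symmetric] this] that(3) show False by simp
      next
        case False
        from no_collision[OF that(1,2) \<open>x $ k \<noteq> y $ k\<close> False] that(3) show False by simp
      qed
    qed
    then show "case p of (A, b) \<Rightarrow> sparse_affine_pr s A b"
      by (auto simp: Ab sparse_affine_pr_def inj_on_def)
  qed
qed

end
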